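(* Let $(h^n_{i,j},u^n_{i,j},v^n_{i,j})$, $0\le n\le N$, be a numerical solution generated by the scheme described in the context, with the stabilisation terms chosen as $$q^{n+1}_{i,j}=\eta\Delta t\bigl(\eth_x\phi^{n+1}_{i,j}-\omega v^n_{i,j}\bigr),\qquad r^{n+1}_{i,j}=\eta\Delta t\bigl(\eth_y\phi^{n+1}_{i,j}+\omega u^n_{i,j}\bigr),$$ where $\eta>0$. Let $\zeta\in(0,1)$ and assume that for all $(i,j)$ and all $0\le n\le N-1$: (1) $\eta>\frac32 h^{n+1}_{i,j}$; (2) $\displaystyle 1+\frac{3\Delta t}{h^{n+1}_{i,j}}\Bigl(\frac1{\Delta x}\bigl(F^{n+1,-}_{i+\frac12,j}-F^{n+1,+}_{i-\frac12,j}\bigr)+\frac1{\Delta y}\bigl(G^{n+1,-}_{i,j+\frac12}-G^{n+1,+}_{i,j-\frac12}\bigr)\Bigr)\ge 0$; (3) $\displaystyle \Delta t^2\le \zeta\,\frac{2h^{n+1}_{i,j}}{3\omega^2\eta^2}\Bigl(\eta-\frac32h^{n+1}_{i,j}\Bigr)$. Then for every $0\le n\le N-1$, $$\sum_{i,j}\Delta x\Delta y\,E^{n+1}_{i,j}\le\sum_{i,j}\Delta x\Delta y\,E^n_{i,j}.$$ Furthermore, for every $1\le n\le N$, $$\sum_{i,j}\Delta x\Delta y\,E^n_{i,j}+\frac g2\sum_{k=0}^{n-1}\sum_{i,j}\Delta x\Delta y\,(h^{k+1}_{i,j}-h^k_{i,j})^2+\sum_{k=0}^{n-1}\sum_{i,j}\Delta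 x\Delta y\,\frac{1-\zeta}{\eta^2}\Bigl(\eta-\frac32h^{k+1}_{i,j}\Bigr)\bigl((q^{k+1}_{i,j})^2+(r^{k+1}_{i,j})^2\bigr)\le\sum_{i,j}\Delta x\Delta y\,E^0_{i,j}.$$
   Context: **Setting.** $\Omega$ is the two-dimensional torus, partitioned (periodic boundary conditions) into a uniform rectangular mesh of cells $K_{i,j}=[x_{i-\frac12},x_{i+\frac12}]\times[y_{j-\frac12},y_{j+\frac12}]$ with constant space steps $\Delta x,\Delta y>0$; the indices $(i,j)$ are periodic and sums over $(i,j)$ run over all cells. $T>0$, and $0=t^0<\dots<t^N=T$ has constant step $\Delta t$. $g>0$ is the gravitational acceleration, $\omega$ (a nonzero real constant) is the Coriolis parameter, $b\in W^{2,\infty}(\Omega)$ is the bottom topography, and $h_0>0$, $u_0$, $v_0$ in $L^\infty(\Omega)$ are the initial data. **Notation.** For a grid function $z=(z_{i,j})$: $\{\{z\}\}_{i+\frac12,j}=\frac12(z_{i,j}+z_{i+1,j})$, $\{\{z\}\}_{i,j+\frac12}=\frac12(z_{i,j}+z_{i,j+1})$; $\eth_xz_{i,j}=\frac{1}{\Delta x}(\{\{z\}\}_{i+\frac12,j}-\{\{z\}\}_{i-\frac12,j})$, $\eth_yz_{i,j}=\frac{1}{\Delta y}(\{\{z\}\}_{i,j+\frac12}-\{\{z\}\}_{i,j-\frac12})$. For real $a$, $a^\pm=\frac12(a\pm|a|)$, so $a^+\ge0$, $a^-\le0$; $F^{n+1,\pm}=(F^{n+1})^\pm$, $G^{n+1,\pm}=(G^{n+1})^\pm$.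 The cell averages are $b_{i,j}=\frac1{\Delta x\Delta y}\int_{K_{i,j}}b$, and likewise $h^0_{i,j},u^0_{i,j},v^0_{i,j}$ are the cell averages of $h_0,u_0,v_0$. **Scheme.** Given stabilisation terms $q^{n+1}_{i,j}, r^{n+1}_{i,j}$, for $0\le n\le N-1$: $$\frac{h^{n+1}_{i,j}-h^n_{i,j}}{\Delta t}+\frac{F^{n+1}_{i+\frac12,j}-F^{n+1}_{i-\frac12,j}}{\Delta x}+\frac{G^{n+1}_{i,j+\frac12}-G^{n+1}_{i,j-\frac12}}{\Delta y}=0,$$ $$\frac{h^{n+1}_{i,j}u^{n+1}_{i,j}-h^n_{i,j}u^n_{i,j}}{\Delta t}+\frac{F^{n+1}_{i+\frac12,j}u^n_{i+\frac12,j}-F^{n+1}_{i-\frac12,j}u^n_{i-\frac12,j}}{\Delta x}+\frac{G^{n+1}_{i,j+\frac12}u^n_{i,j+\frac12}-G^{n+1}_{i,j-\frac12}u^n_{i,j-\frac12}}{\Delta y}+h^{n+1}_{i,j}\eth_x\phi^{n+1}_{i,j}=\omega h^{n+1}_{i,j}v^n_{i,j}-\omega r^{n+1}_{i,j},$$ $$\frac{h^{n+1}_{i,j}v^{n+1}_{i,j}-h^n_{i,j}v^n_{i,j}}{\Delta t}+\frac{F^{n+1}_{i+\frac12,j}v^n_{i+\frac12,j}-F^{n+1}_{i-\frac12,j}v^n_{i-\frac12,j}}{\Delta x}+\frac{G^{n+1}_{i,j+\frac12}v^n_{i,j+\frac12}-G^{n+1}_{i,j-\frac12}v^n_{i,j-\frac12}}{\Delta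 y}+h^{n+1}_{i,j}\eth_y\phi^{n+1}_{i,j}=-\omega h^{n+1}_{i,j}u^n_{i,j}+\omega q^{n+1}_{i,j}.$$ Here $\phi^{n}_{i,j}=g(h^{n}_{i,j}+b_{i,j})$, the fluxes are $$F^{n+1}_{i+\frac12,j}=\{\{h^{n+1}u^n\}\}_{i+\frac12,j}-\{\{q^{n+1}\}\}_{i+\frac12,j},\qquad G^{n+1}_{i,j+\frac12}=\{\{h^{n+1}v^n\}\}_{i,j+\frac12}-\{\{r^{n+1}\}\}_{i,j+\frac12},$$ and the edge velocities are upwind: for $w=u,v$, $w^n_{i+\frac12,j}=w^n_{i,j}$ if $F^{n+1}_{i+\frac12,j}\ge0$ and $w^n_{i+1,j}$ otherwise; $w^n_{i,j+\frac12}=w^n_{i,j}$ if $G^{n+1}_{i,j+\frac12}\ge0$ and $w^n_{i,j+1}$ otherwise. **Energy.** $E^n_{i,j}=\frac12g(h^n_{i,j})^2+g\,b_{i,j}h^n_{i,j}+\frac12h^n_{i,j}\bigl((u^n_{i,j})^2+(v^n_{i,j})^2\bigr)$. *)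

theory Defs
  imports "HOL-Analysis.Analysis"
begin

section \<open>Function spaces on the two-dimensional torus\<close>

text \<open>Functions on the torus with side lengths \<open>Lx\<close>, \<open>Ly\<close> are doubly periodic functions on the
  plane. Elements of \<open>L\<^sup>\<infinity>\<close> are given by periodic, Lebesgue measurable representatives.\<close>

definition torus_periodic :: "real \<Rightarrow> real \<Rightarrow> (real \<times> real \<Rightarrow> real) \<Rightarrow> bool" where
  "torus_periodic Lx Ly f \<longleftrightarrow>
     (\<forall>x y. f (x + Lx, y) = f (x, y) \<and> f (x, y + Ly) = f (x, y))"

definition torus_Linf :: "real \<Rightarrow> real \<Rightarrow> (real \<times> real \<Rightarrow> real) \<Rightarrow> bool" where
  "torus_Linf Lx Ly f \<longleftrightarrow>
     torus_periodic Lx Ly f \<and> f \<in> borel_measurable lebesgue \<and>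
     (\<exists>C. AE p in lebesgue. \<bar>f p\<bar> \<le> C)"

text \<open>\<open>smooth_jet D\<close>: the function \<open>D 0 0\<close> is smooth on the plane, and \<open>D \<alpha> \<beta>\<close> is its partial
  derivative of order \<open>\<alpha>\<close> in the first and \<open>\<beta>\<close> in the second variable.\<close>

definition smooth_jet :: "(nat \<Rightarrow> nat \<Rightarrow> real \<times> real \<Rightarrow> real) \<Rightarrow> bool" where
  "smooth_jet D \<longleftrightarrow>
     (\<forall>\<alpha> \<beta> p. (D \<alpha> \<beta> has_derivative
                 (\<lambda>e. fst e * D (Suc \<alpha>) \<beta> p + snd e * D \<alpha> (Suc \<beta>) p)) (at p))"

text \<open>The torus has no boundary, so the test functions are all smooth periodic functions; integrals
  over the torus are integrals over one period cell.\<close>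

definition torus_weak_deriv ::
  "real \<Rightarrow> real \<Rightarrow> nat \<Rightarrow> nat \<Rightarrow> (real \<times> real \<Rightarrow> real) \<Rightarrow> (real \<times> real \<Rightarrow> real) \<Rightarrow> bool" where
  "torus_weak_deriv Lx Ly \<alpha> \<beta> f w \<longleftrightarrow>
     (\<forall>D. smooth_jet D \<and> torus_periodic Lx Ly (D 0 0) \<longrightarrow>
        (LINT p:cbox (0, 0) (Lx, Ly)|lebesgue. f p * D \<alpha> \<beta> p) =
        (- 1) ^ (\<alpha> + \<beta>) * (LINT p:cbox (0, 0) (Lx, Ly)|lebesgue. w p * D 0 0 p))"

definition torus_Wkinf :: "nat \<Rightarrow> real \<Rightarrow> real \<Rightarrow> (real \<times> real \<Rightarrow> real) \<Rightarrow> bool" where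
  "torus_Wkinf k Lx Ly f \<longleftrightarrow>
     torus_Linf Lx Ly f \<and>
     (\<forall>\<alpha> \<beta>. \<alpha> + \<beta> \<le> k \<longrightarrow> (\<exists>w. torus_Linf Lx Ly w \<and> torus_weak_deriv Lx Ly \<alpha> \<beta> f w))"


section \<open>Grid functions\<close>

text \<open>A grid function on the \<open>nx \<times> ny\<close> periodic mesh is a function on all integer pairs with periods
  \<open>nx\<close> and \<open>ny\<close>.\<close>

type_synonym grid = "int \<Rightarrow> int \<Rightarrow> real"

definition grid_periodic :: "nat \<Rightarrow> nat \<Rightarrow> grid \<Rightarrow> bool" where
  "grid_periodic nx ny z \<longleftrightarrow>
     (\<forall>i j. z (i + int nx) j = z i j \<and> z i (j + int ny) = z i j)"

definition grid_sum :: "nat \<Rightarrow> nat \<Rightarrow> grid \<Rightarrow> real" where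
  "grid_sum nx ny z = (\<Sum>i\<in>{0..<int nx}. \<Sum>j\<in>{0..<int ny}. z i j)"

text \<open>The point \<open>(x0, y0)\<close> is the lower left corner of the cell with index \<open>(0, 0)\<close>.\<close>

definition cell :: "real \<Rightarrow> real \<Rightarrow> real \<Rightarrow> real \<Rightarrow> int \<Rightarrow> int \<Rightarrow> (real \<times> real) set" where
  "cell x0 y0 dx dy i j =
     cbox (x0 + of_int i * dx, y0 + of_int j * dy)
          (x0 + of_int (i + 1) * dx, y0 + of_int (j + 1) * dy)"

definition cell_avg :: "real \<Rightarrow> real \<Rightarrow> real \<Rightarrow> real \<Rightarrow> (real \<times> real \<Rightarrow> real) \<Rightarrow> grid" where
  "cell_avg x0 y0 dx dy f i j = 1 / (dx * dy) * (LINT p:cell x0 y0 dx dy i j|lebesgue. f p)"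

text \<open>Edge quantities are indexed by the cell to the left of, respectively below, the edge:
  index \<open>(i, j)\<close> stands for \<open>(i + 1/2, j)\<close> in the \<open>x\<close>-direction and for \<open>(i, j + 1/2)\<close> in the
  \<open>y\<close>-direction.\<close>

definition avg_x :: "grid \<Rightarrow> grid" where
  "avg_x z i j = 1 / 2 * (z i j + z (i + 1) j)"

definition avg_y :: "grid \<Rightarrow> grid" where
  "avg_y z i j = 1 / 2 * (z i j + z i (j + 1))"

definition diff_x :: "real \<Rightarrow> grid \<Rightarrow> grid" where
  "diff_x dx z i j = 1 / dx * (avg_x z i j - avg_x z (i - 1) j)"

definition diff_y :: "real \<Rightarrow> grid \<Rightarrow> grid" where
  "diff_y dy z i j = 1 / dy * (avg_y z i j - avg_y z i (j - 1))"

definition upwind_x :: "grid \<Rightarrow> grid \<Rightarrow> grid" where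
  "upwind_x F w i j = (if F i j \<ge> 0 then w i j else w (i + 1) j)"

definition upwind_y :: "grid \<Rightarrow> grid \<Rightarrow> grid" where
  "upwind_y G w i j = (if G i j \<ge> 0 then w i j else w i (j + 1))"

definition pos_part :: "real \<Rightarrow> real" where
  "pos_part a = 1 / 2 * (a + \<bar>a\<bar>)"

definition neg_part :: "real \<Rightarrow> real" where
  "neg_part a = 1 / 2 * (a - \<bar>a\<bar>)"


section \<open>The scheme\<close>

definition potential :: "real \<Rightarrow> grid \<Rightarrow> grid \<Rightarrow> grid" where
  "potential g b h i j = g * (h i j + b i j)"

definition flux_x :: "grid \<Rightarrow> grid \<Rightarrow> grid \<Rightarrow> grid" where
  "flux_x h' u q i j = avg_x (\<lambda>i j. h' i j * u i j) i j - avg_x q i j"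

definition flux_y :: "grid \<Rightarrow> grid \<Rightarrow> grid \<Rightarrow> grid" where
  "flux_y h' v r i j = avg_y (\<lambda>i j. h' i j * v i j) i j - avg_y r i j"

text \<open>One time step, from \<open>(h, u, v)\<close> at time level \<open>n\<close> to \<open>(h', u', v')\<close> at level \<open>n + 1\<close>; the
  stabilisation terms \<open>q\<close>, \<open>r\<close> are those of level \<open>n + 1\<close>, and \<open>b\<close> is the grid function of cell
  averages of the topography.\<close>

definition scheme_step ::
  "real \<Rightarrow> real \<Rightarrow> real \<Rightarrow> real \<Rightarrow> real \<Rightarrow> grid \<Rightarrow>
   grid \<Rightarrow> grid \<Rightarrow> grid \<Rightarrow> grid \<Rightarrow> grid \<Rightarrow> grid \<Rightarrow> grid \<Rightarrow> grid \<Rightarrow> bool" where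
  "scheme_step g \<omega> dx dy dt b h u v h' u' v' q r \<longleftrightarrow>
     (let F = flux_x h' u q; G = flux_y h' v r; \<phi>' = potential g b h' in
      \<forall>i j.
        (h' i j - h i j) / dt
          + (F i j - F (i - 1) j) / dx
          + (G i j - G i (j - 1)) / dy = 0 \<and>
        (h' i j * u' i j - h i j * u i j) / dt
          + (F i j * upwind_x F u i j - F (i - 1) j * upwind_x F u (i - 1) j) / dx
          + (G i j * upwind_y G u i j - G i (j - 1) * upwind_y G u i (j - 1)) / dy
          + h' i j * diff_x dx \<phi>' i j
          = \<omega> * h' i j * v i j - \<omega> * r i j \<and>
        (h' i j * v' i j - h i j * v i j) / dt
          + (F i j * upwind_x F v i j - F (i - 1) j * upwind_x F v (i - 1) j) / dx
          + (G i j * upwind_y G v i j - G i (j - 1) * upwind_y G v i (j - 1)) / dy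
          + h' i j * diff_y dy \<phi>' i j
          = - \<omega> * h' i j * u i j + \<omega> * q i j)"

definition energy :: "real \<Rightarrow> grid \<Rightarrow> grid \<Rightarrow> grid \<Rightarrow> grid \<Rightarrow> grid" where
  "energy g b h u v i j =
     1 / 2 * g * (h i j)\<^sup>2 + g * b i j * h i j + 1 / 2 * h i j * ((u i j)\<^sup>2 + (v i j)\<^sup>2)"

end

theory Submission imports Defs begin

text \<open>The energy decreases because it satisfies a local inequality, in every cell and every time
  step, in which all unsigned contributions are differences of an energy flux. Summation over the
  periodic mesh then removes the flux, and summation over the time steps gives the second estimate.

  Write \<open>h'\<close> for the new height and \<open>\<phi>'\<close> for the new potential. The choice of \<open>q\<close> and \<open>r\<close> says that
  \<open>dt (\<partial>\<^sub>x \<phi>' - \<omega> v) = q / \<eta>\<close> and \<open>dt (\<partial>\<^sub>y \<phi>' + \<omega> u) = r / \<eta>\<close>, where the derivatives are central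
  differences. The proof combines the following balances.

  \<^item> Potential energy: \<open>g h\<^sup>2 / 2 + g b h\<close> is quadratic in \<open>h\<close>, so its increment is
    \<open>\<phi>' (h' - h) - g (h' - h)\<^sup>2 / 2\<close>. The mass equation turns \<open>h' - h\<close> into a central difference of
    \<open>h' u - q\<close> and \<open>h' v - r\<close>, and a discrete product rule moves this difference onto \<open>\<phi>'\<close>. There the
    stabilisation produces the dissipation \<open>- (q\<^sup>2 + r\<^sup>2) / \<eta>\<close>.
  \<^item> Kinetic energy: by the mass equation, a momentum equation becomes
    \<open>h' (w' - w) = X + a + c\<close>, where \<open>X\<close> is a nonnegative combination of differences with the upwind
    neighbours, \<open>a = - h' q / \<eta>\<close> (or \<open>- h' r / \<eta>\<close>) comes from pressure and Coriolis force,
    and \<open>c = - \<omega> dt r\<close> (or \<open>\<omega> dt q\<close>) from the stabilisation of the Coriolis force.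
  \<^item> Exchange: multiplied by the old velocity and added over both components, the impulses \<open>a + c\<close>
    give the work that is cancelled exactly by the remaining terms of the potential energy balance.

  The explicit time step leaves the nonnegative term \<open>h' (w' - w)\<^sup>2 / 2\<close>. Splitting its square into three
  parts, which is where the factors 3 in the hypotheses come from, leaves \<open>X\<^sup>2\<close>, absorbed by the upwind
  dissipation under the CFL condition; \<open>a\<^sup>2\<close>, which lowers the coefficient \<open>\<eta>\<close> of the stabilisation to
  \<open>\<eta> - 3 h' / 2\<close>; and \<open>c\<^sup>2\<close>, which by the bound on the time step uses at most the fraction \<open>\<zeta>\<close> of what
  is then left.

  The lemma \<open>local_energy_inequality\<close> puts these together, and \<open>global_energy_inequality\<close> sums over the
  mesh. That the flux is periodic requires the cell averages of the topography to be periodic, which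
  is translation invariance of the Lebesgue integral.\<close>

section \<open>Periodic grid functions and their sums\<close>

text \<open>The index shifts that occur in difference quotients and fluxes, in the form to which
  simplification brings them.\<close>

lemma grid_periodic_neighbours:
  assumes "grid_periodic nx ny z"
  shows "z (i + int nx) j = z i j" "z i (j + int ny) = z i j"
    "z (i + int nx + 1) j = z (i + 1) j" "z i (j + int ny + 1) = z i (j + 1)"
    "z (i + int nx - 1) j = z (i - 1) j" "z i (j + int ny - 1) = z i (j - 1)"
proof -
  have p: "z (k + int nx) l = z k l" "z k (l + int ny) = z k l" for k l
    using assms by (auto simp: grid_periodic_def)
  show "z (i + int nx) j = z i j" "z i (j + int ny) = z i j"
    by (fact p)+
  show "z (i + int nx + 1) j = z (i + 1) j" "z i (j + int ny + 1) = z i (j + 1)"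
    "z (i + int nx - 1) j = z (i - 1) j" "z i (j + int ny - 1) = z i (j - 1)"
    using p(1)[of "i + 1" j] p(2)[of i "j + 1"] p(1)[of "i - 1" j] p(2)[of i "j - 1"]
    by (simp_all add: algebra_simps)
qed

lemma sum_periodic_telescope:
  fixes f :: "int \<Rightarrow> real"
  assumes "\<And>i. f (i + int n) = f i"
  shows "(\<Sum>i\<in>{0..<int n}. f i - f (i - 1)) = 0"
proof -
  have "(\<Sum>i\<in>{0..<int n}. f i - f (i - 1)) = (\<Sum>k<n. f (int k) - f (int k - 1))"
    by (rule sum.reindex_bij_witness[of _ int nat]) auto
  also have "\<dots> = (\<Sum>k<n. f (int (Suc k) - 1) - f (int k - 1))"
    by simp
  also have "\<dots> = f (int n - 1) - f (- 1)"
    by (subst sum_lessThan_telescope) simp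
  also have "\<dots> = 0"
    using assms[of "- 1"] by (simp add: add.commute)
  finally show ?thesis .
qed

lemma grid_sum_div_x:
  assumes "grid_periodic nx ny z"
  shows "grid_sum nx ny (\<lambda>i j. z i j - z (i - 1) j) = 0"
  unfolding grid_sum_def
  by (subst sum.swap) (use assms in \<open>auto simp: grid_periodic_def intro!: sum.neutral sum_periodic_telescope\<close>)

lemma grid_sum_div_y:
  assumes "grid_periodic nx ny z"
  shows "grid_sum nx ny (\<lambda>i j. z i j - z i (j - 1)) = 0"
  unfolding grid_sum_def
  using assms by (auto simp: grid_periodic_def intro!: sum.neutral sum_periodic_telescope)

section \<open>Cell averages of periodic functions\<close>

lemma lebesgue_distr_translation:
  fixes a :: "'a::euclidean_space"
  shows "distr lebesgue lebesgue (\<lambda>x. a + x) = lebesgue"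
    and "(\<lambda>x. a + x) \<in> lebesgue \<rightarrow>\<^sub>M lebesgue"
proof -
  have T: "(\<lambda>x. a + (\<Sum>j\<in>Basis. (1 * (x \<bullet> j)) *\<^sub>R j)) = (\<lambda>x. a + x)"
    by (simp add: euclidean_representation)
  show "distr lebesgue lebesgue (\<lambda>x. a + x) = lebesgue"
    using lebesgue_affine_euclidean[of "\<lambda>_. 1" a] unfolding T by (simp add: density_1)
  show "(\<lambda>x. a + x) \<in> lebesgue \<rightarrow>\<^sub>M lebesgue"
    using lebesgue_affine_measurable[of "\<lambda>_. 1" a] unfolding T by simp
qed

lemma set_integral_translation_invariant:
  fixes f :: "'a::euclidean_space \<Rightarrow> real"
  assumes f: "f \<in> borel_measurable lebesgue" and A: "A \<in> sets lebesgue"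
    and inv: "\<And>p. f (a + p) = f p"
  shows "(LINT p:(+) a ` A|lebesgue. f p) = (LINT p:A|lebesgue. f p)"
proof -
  let ?g = "\<lambda>p. indicat_real ((+) a ` A) p *\<^sub>R f p"
  have aA: "(+) a ` A \<in> sets lebesgue"
    using lebesgue_sets_translation[OF A] .
  have "integral\<^sup>L lebesgue ?g = integral\<^sup>L (distr lebesgue lebesgue (\<lambda>x. a + x)) ?g"
    by (simp only: lebesgue_distr_translation)
  also have "\<dots> = integral\<^sup>L lebesgue (\<lambda>p. ?g (a + p))"
    using f aA by (intro integral_distr lebesgue_distr_translation) auto
  also have "\<dots> = integral\<^sup>L lebesgue (\<lambda>p. indicat_real A p *\<^sub>R f p)"
    by (intro Bochner_Integration.integral_cong) (auto simp: inv indicator_def)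
  finally show ?thesis by (simp add: set_lebesgue_integral_def)
qed

lemma cell_avg_periodic:
  assumes f: "torus_Linf (real nx * dx) (real ny * dy) f"
  shows "grid_periodic nx ny (cell_avg x0 y0 dx dy f)"
proof -
  have m: "f \<in> borel_measurable lebesgue"
    and px: "\<And>p. f ((real nx * dx, 0) + p) = f p" and py: "\<And>p. f ((0, real ny * dy) + p) = f p"
    using f by (auto simp: torus_Linf_def torus_periodic_def add.commute)
  have "cell x0 y0 dx dy (i + int nx) j = (+) (real nx * dx, 0) ` cell x0 y0 dx dy i j"
   and "cell x0 y0 dx dy i (j + int ny) = (+) (0, real ny * dy) ` cell x0 y0 dx dy i j" for i j
    unfolding cell_def cbox_translation[symmetric] by (simp_all add: algebra_simps)
  moreover have "cell x0 y0 dx dy i j \<in> sets lebesgue" for i j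
    by (simp add: cell_def)
  ultimately show ?thesis
    unfolding grid_periodic_def cell_avg_def
    by (simp add: set_integral_translation_invariant[OF m] px py)
qed

section \<open>Kinetic energy under upwind transport\<close>

text \<open>By Lagrange's identity, the difference of the two sides is the sum of
  \<open>c\<^sub>i c\<^sub>j (d\<^sub>i - d\<^sub>j)\<^sup>2\<close> over all pairs.\<close>

lemma weighted_cauchy_four:
  fixes c1 :: real
  assumes "c1 \<ge> 0" "c2 \<ge> 0" "c3 \<ge> 0" "c4 \<ge> 0"
  shows "(c1*d1 + c2*d2 + c3*d3 + c4*d4)\<^sup>2
    \<le> (c1 + c2 + c3 + c4) * (c1*d1\<^sup>2 + c2*d2\<^sup>2 + c3*d3\<^sup>2 + c4*d4\<^sup>2)"
proof -
  have "(c1 + c2 + c3 + c4) * (c1*d1\<^sup>2 + c2*d2\<^sup>2 + c3*d3\<^sup>2 + c4*d4\<^sup>2)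
     - (c1*d1 + c2*d2 + c3*d3 + c4*d4)\<^sup>2
     = c1*c2*(d1-d2)\<^sup>2 + c1*c3*(d1-d3)\<^sup>2 + c1*c4*(d1-d4)\<^sup>2
       + c2*c3*(d2-d3)\<^sup>2 + c2*c4*(d2-d4)\<^sup>2 + c3*c4*(d3-d4)\<^sup>2"
    by (simp add: power2_eq_square algebra_simps)
  also have "\<dots> \<ge> 0" using assms by (intro add_nonneg_nonneg mult_nonneg_nonneg) auto
  finally show ?thesis by simp
qed

lemma square_sum3_le: "((x::real) + y + z)\<^sup>2 \<le> 3 * (x\<^sup>2 + y\<^sup>2 + z\<^sup>2)"
proof -
  have "3 * (x\<^sup>2 + y\<^sup>2 + z\<^sup>2) - (x + y + z)\<^sup>2 = (x-y)\<^sup>2 + (y-z)\<^sup>2 + (x-z)\<^sup>2"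
    by (simp add: power2_eq_square algebra_simps)
  then show ?thesis by (smt (verit) zero_le_power2)
qed

text \<open>Kinetic energy balance for one velocity component \<open>w\<close> that is transported by upwind fluxes and
  receives the impulses \<open>a\<close> and \<open>c\<close>. The upwind dissipation pays for the transport part of the
  explicit time stepping error. The error due to \<open>a\<close> and \<open>c\<close> stays on the right, to be paid for by the
  stabilisation terms.\<close>

lemma upwind_kinetic_energy:
  fixes F G :: grid and w w' h h' :: grid
  assumes pos: "dt > 0" "dx > 0" "dy > 0" "h' i j > 0"
    and mass: "(h' i j - h i j) / dt + (F i j - F (i - 1) j) / dx + (G i j - G i (j - 1)) / dy = 0"
    and momentum: "(h' i j * w' i j - h i j * w i j) / dt
      + (F i j * upwind_x F w i j - F (i - 1) j * upwind_x F w (i - 1) j) / dx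
      + (G i j * upwind_y G w i j - G i (j - 1) * upwind_y G w i (j - 1)) / dy = (a + c) / dt"
    and cfl: "1 + 3 * dt / h' i j *
      (1 / dx * (neg_part (F i j) - pos_part (F (i - 1) j))
       + 1 / dy * (neg_part (G i j) - pos_part (G i (j - 1)))) \<ge> 0"
  shows "1 / 2 * h' i j * (w' i j)\<^sup>2 - 1 / 2 * h i j * (w i j)\<^sup>2
      + dt * ((F i j * (upwind_x F w i j)\<^sup>2 / 2 - F (i - 1) j * (upwind_x F w (i - 1) j)\<^sup>2 / 2) / dx
      + (G i j * (upwind_y G w i j)\<^sup>2 / 2 - G i (j - 1) * (upwind_y G w i (j - 1))\<^sup>2 / 2) / dy)
    \<le> w i j * (a + c) + 3 / (2 * h' i j) * (a\<^sup>2 + c\<^sup>2)"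
proof -
  \<comment> \<open>With the weights \<open>cE\<close>, \<open>cW\<close>, \<open>cN\<close>, \<open>cS\<close> of the inflowing neighbours and the jumps \<open>dE\<close>, \<open>dW\<close>,
    \<open>dN\<close>, \<open>dS\<close> towards them, upwinding makes the transport relax \<open>w\<close> towards its neighbours.\<close>
  define H where "H = h' i j"
  define W where "W = w i j"
  define cE where "cE = - neg_part (F i j) / dx"
  define cW where "cW = pos_part (F (i - 1) j) / dx"
  define cN where "cN = - neg_part (G i j) / dy"
  define cS where "cS = pos_part (G i (j - 1)) / dy"
  define dE where "dE = w (i + 1) j - W"
  define dW where "dW = w (i - 1) j - W"
  define dN where "dN = w i (j + 1) - W"
  define dS where "dS = w i (j - 1) - W"
  define C where "C = cE + cW + cN + cS"
  define X where "X = dt * (cE * dE + cW * dW + cN * dN + cS * dS)"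
  define D where "D = cE * dE\<^sup>2 + cW * dW\<^sup>2 + cN * dN\<^sup>2 + cS * dS\<^sup>2"
  define divF where "divF = (F i j - F (i - 1) j) / dx + (G i j - G i (j - 1)) / dy"
  have H: "H > 0" using pos by (simp add: H_def)
  have nonneg: "cE \<ge> 0" "cW \<ge> 0" "cN \<ge> 0" "cS \<ge> 0"
    using pos by (auto simp: cE_def cW_def cN_def cS_def neg_part_def pos_part_def divide_le_0_iff)
  have D0: "D \<ge> 0" unfolding D_def using nonneg by simp
  have m: "H - h i j + dt * divF = 0"
    using mass pos by (simp add: H_def divF_def field_simps)
  \<comment> \<open>The function \<open>f\<close> is the identity for momentum and half the square for kinetic energy.\<close>
  have upwind:
    "F i j * f (upwind_x F w i j) = F i j * f W + neg_part (F i j) * (f (W + dE) - f W)"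
    "F (i - 1) j * f (upwind_x F w (i - 1) j)
      = F (i - 1) j * f W + pos_part (F (i - 1) j) * (f (W + dW) - f W)"
    "G i j * f (upwind_y G w i j) = G i j * f W + neg_part (G i j) * (f (W + dN) - f W)"
    "G i (j - 1) * f (upwind_y G w i (j - 1))
      = G i (j - 1) * f W + pos_part (G i (j - 1)) * (f (W + dS) - f W)"
    for f :: "real \<Rightarrow> real"
    by (auto simp: upwind_x_def upwind_y_def W_def dE_def dW_def dN_def dS_def
      pos_part_def neg_part_def algebra_simps)
  have flux: "(F i j * f (upwind_x F w i j) - F (i - 1) j * f (upwind_x F w (i - 1) j)) / dx
      + (G i j * f (upwind_y G w i j) - G i (j - 1) * f (upwind_y G w i (j - 1))) / dy
    = divF * f W - (cE * (f (W + dE) - f W) + cW * (f (W + dW) - f W)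
       + cN * (f (W + dN) - f W) + cS * (f (W + dS) - f W))" for f :: "real \<Rightarrow> real"
    unfolding upwind cE_def cW_def cN_def cS_def divF_def using pos by (simp add: field_simps)
  have "(H * w' i j - h i j * W) / dt + (divF * W - (cE * dE + cW * dW + cN * dN + cS * dS))
      = (a + c) / dt"
    using momentum flux[of "\<lambda>x. x"] unfolding H_def[symmetric] W_def[symmetric] by simp
  then have "(H * w' i j - h i j * W) + dt * (divF * W) - X = a + c"
    using pos by (simp add: X_def field_simps)
  \<comment> \<open>Subtracting \<open>W\<close> times the mass equation removes the divergence of the flux.\<close>
  moreover have "h i j * W = (H + dt * divF) * W" using m by simp
  ultimately have incr: "H * (w' i j - W) = X + a + c" by (simp add: algebra_simps)
  have flux2: "(F i j * (upwind_x F w i j)\<^sup>2 / 2 - F (i - 1) j * (upwind_x F w (i - 1) j)\<^sup>2 / 2) / dx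
      + (G i j * (upwind_y G w i j)\<^sup>2 / 2 - G i (j - 1) * (upwind_y G w i (j - 1))\<^sup>2 / 2) / dy
    = divF * W\<^sup>2 / 2 - (W * (cE * dE + cW * dW + cN * dN + cS * dS) + D / 2)"
    using flux[of "\<lambda>x. x\<^sup>2 / 2"] by (simp add: D_def power2_eq_square algebra_simps add_divide_distrib)
  \<comment> \<open>By the CFL condition, the upwind dissipation \<open>dt * D / 2\<close> dominates \<open>3 * X\<^sup>2 / (2 * H)\<close>.\<close>
  have "X\<^sup>2 \<le> dt\<^sup>2 * (C * D)"
    unfolding X_def C_def D_def power_mult_distrib
    by (intro mult_left_mono weighted_cauchy_four nonneg) auto
  moreover have "3 * dt * C \<le> H"
  proof -
    have "1 / dx * (neg_part (F i j) - pos_part (F (i - 1) j))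
       + 1 / dy * (neg_part (G i j) - pos_part (G i (j - 1))) = - C"
      by (simp add: C_def cE_def cW_def cN_def cS_def diff_divide_distrib)
    then show ?thesis using cfl H by (simp add: H_def[symmetric] field_simps)
  qed
  then have "3 * (dt * C) * (dt * D) \<le> H * (dt * D)"
    using D0 pos by (intro mult_right_mono) auto
  ultimately have X: "3 * X\<^sup>2 \<le> H * (dt * D)"
    by (simp add: power2_eq_square algebra_simps)
  have "1 / 2 * H * (w' i j)\<^sup>2 - 1 / 2 * h i j * W\<^sup>2 + dt * (divF * W\<^sup>2 / 2)
      = W * (H * (w' i j - W)) + (H * (w' i j - W))\<^sup>2 / (2 * H)"
  proof -
    have "h i j = H + dt * divF" using m by simp
    then show ?thesis using H by (simp add: field_simps power2_eq_square)
  qed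
  also have "\<dots> = W * X + W * (a + c) + (X + a + c)\<^sup>2 / (2 * H)"
    unfolding incr by (simp add: algebra_simps)
  also have "\<dots> \<le> W * X + W * (a + c) + (H * (dt * D) + 3 * (a\<^sup>2 + c\<^sup>2)) / (2 * H)"
    using X square_sum3_le[of X a c] H by (intro add_mono divide_right_mono) auto
  also have "\<dots> = W * X + W * (a + c) + dt * D / 2 + 3 / (2 * H) * (a\<^sup>2 + c\<^sup>2)"
    using H by (simp add: field_simps)
  finally show ?thesis
    unfolding flux2 H_def[symmetric] W_def[symmetric] by (simp add: X_def algebra_simps)
qed

section \<open>Potential energy under central differences\<close>

text \<open>Edge products that play the role of \<open>y z\<close> in the product rule for central differences.\<close>

definition cross_x :: "grid \<Rightarrow> grid \<Rightarrow> grid" where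
  "cross_x y z i j = 1 / 2 * (y i j * z (i + 1) j + z i j * y (i + 1) j)"

definition cross_y :: "grid \<Rightarrow> grid \<Rightarrow> grid" where
  "cross_y y z i j = 1 / 2 * (y i j * z i (j + 1) + z i j * y i (j + 1))"

lemma discrete_product_rule:
  "y i j * diff_x dx z i j + z i j * diff_x dx y i j
     = (cross_x y z i j - cross_x y z (i - 1) j) / dx"
  "y i j * diff_y dy z i j + z i j * diff_y dy y i j
     = (cross_y y z i j - cross_y y z i (j - 1)) / dy"
  by (simp_all add: diff_x_def avg_x_def cross_x_def diff_y_def avg_y_def cross_y_def
    diff_divide_distrib add_divide_distrib algebra_simps)

lemma flux_divergence:
  "(flux_x h' u q i j - flux_x h' u q (i - 1) j) / dx = diff_x dx (\<lambda>i j. h' i j * u i j - q i j) i j"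
  "(flux_y h' v r i j - flux_y h' v r i (j - 1)) / dy = diff_y dy (\<lambda>i j. h' i j * v i j - r i j) i j"
  by (simp_all add: diff_x_def avg_x_def flux_x_def diff_y_def avg_y_def flux_y_def
    diff_divide_distrib add_divide_distrib algebra_simps)

text \<open>The terms \<open>h' u q / \<eta>\<close>, \<open>h' v r / \<eta>\<close> and \<open>\<omega> dt (u r - v q)\<close> on the right have no sign. They
  are the opposites of the work that appears in the two kinetic energy balances. The implicit treatment
  of \<open>h'\<close> in the potential is what gives \<open>(h' - h)\<^sup>2\<close> its minus sign.\<close>

lemma potential_energy_balance:
  fixes g \<omega> dx dy dt \<eta> :: real and b h u v h' q r :: grid
  defines "\<phi> \<equiv> potential g b h'"
  assumes pos: "dt > 0" "\<eta> > 0"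
    and mass: "(h' i j - h i j) / dt + (flux_x h' u q i j - flux_x h' u q (i - 1) j) / dx
      + (flux_y h' v r i j - flux_y h' v r i (j - 1)) / dy = 0"
    and q: "q i j = \<eta> * dt * (diff_x dx \<phi> i j - \<omega> * v i j)"
    and r: "r i j = \<eta> * dt * (diff_y dy \<phi> i j + \<omega> * u i j)"
  shows "1 / 2 * g * (h' i j)\<^sup>2 + g * b i j * h' i j - (1 / 2 * g * (h i j)\<^sup>2 + g * b i j * h i j)
      + dt * ((cross_x \<phi> (\<lambda>i j. h' i j * u i j - q i j) i j
               - cross_x \<phi> (\<lambda>i j. h' i j * u i j - q i j) (i - 1) j) / dx
            + (cross_y \<phi> (\<lambda>i j. h' i j * v i j - r i j) i j
               - cross_y \<phi> (\<lambda>i j. h' i j * v i j - r i j) i (j - 1)) / dy)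
    = h' i j * (u i j * q i j + v i j * r i j) / \<eta> - ((q i j)\<^sup>2 + (r i j)\<^sup>2) / \<eta>
      + \<omega> * dt * (u i j * r i j - v i j * q i j) - g / 2 * (h' i j - h i j)\<^sup>2"
proof -
  let ?Z = "\<lambda>i j. h' i j * u i j - q i j" and ?Y = "\<lambda>i j. h' i j * v i j - r i j"
  have m: "h' i j - h i j = - dt * (diff_x dx ?Z i j + diff_y dy ?Y i j)"
    using mass pos unfolding flux_divergence by (simp add: field_simps)
  have gx: "dt * diff_x dx \<phi> i j = q i j / \<eta> + \<omega> * dt * v i j"
    and gy: "dt * diff_y dy \<phi> i j = r i j / \<eta> - \<omega> * dt * u i j"
    using pos unfolding q r by (simp_all add: field_simps)
  have "1 / 2 * g * (h' i j)\<^sup>2 + g * b i j * h' i j - (1 / 2 * g * (h i j)\<^sup>2 + g * b i j * h i j)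
    = \<phi> i j * (h' i j - h i j) - g / 2 * (h' i j - h i j)\<^sup>2"
    by (simp add: \<phi>_def potential_def power2_eq_square algebra_simps)
  moreover have "\<phi> i j * (h' i j - h i j) = - dt * (\<phi> i j * diff_x dx ?Z i j + \<phi> i j * diff_y dy ?Y i j)"
    unfolding m by (simp add: algebra_simps)
  moreover have "dt * ((cross_x \<phi> ?Z i j - cross_x \<phi> ?Z (i - 1) j) / dx
            + (cross_y \<phi> ?Y i j - cross_y \<phi> ?Y i (j - 1)) / dy)
      = dt * (\<phi> i j * diff_x dx ?Z i j + \<phi> i j * diff_y dy ?Y i j)
        + (?Z i j * (dt * diff_x dx \<phi> i j) + ?Y i j * (dt * diff_y dy \<phi> i j))"
    unfolding discrete_product_rule[symmetric] by (simp add: algebra_simps)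
  moreover have "?Z i j * (dt * diff_x dx \<phi> i j) + ?Y i j * (dt * diff_y dy \<phi> i j)
     = h' i j * (u i j * q i j + v i j * r i j) / \<eta> - ((q i j)\<^sup>2 + (r i j)\<^sup>2) / \<eta>
      + \<omega> * dt * (u i j * r i j - v i j * q i j)"
    unfolding gx gy by (simp add: power2_eq_square algebra_simps add_divide_distrib)
  ultimately show ?thesis by simp
qed

section \<open>The local energy inequality\<close>

text \<open>The energy flux consists of the upwind transport of the kinetic energy and of the edge product
  of the potential with the mass flux, which contains the work of the pressure.\<close>

definition energy_flux_x :: "real \<Rightarrow> grid \<Rightarrow> grid \<Rightarrow> grid \<Rightarrow> grid \<Rightarrow> grid \<Rightarrow> grid" where
  "energy_flux_x g b u v h' q i j =
     flux_x h' u q i j * (upwind_x (flux_x h' u q) u i j)\<^sup>2 / 2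
     + flux_x h' u q i j * (upwind_x (flux_x h' u q) v i j)\<^sup>2 / 2
     + cross_x (potential g b h') (\<lambda>i j. h' i j * u i j - q i j) i j"

definition energy_flux_y :: "real \<Rightarrow> grid \<Rightarrow> grid \<Rightarrow> grid \<Rightarrow> grid \<Rightarrow> grid \<Rightarrow> grid" where
  "energy_flux_y g b u v h' r i j =
     flux_y h' v r i j * (upwind_y (flux_y h' v r) u i j)\<^sup>2 / 2
     + flux_y h' v r i j * (upwind_y (flux_y h' v r) v i j)\<^sup>2 / 2
     + cross_y (potential g b h') (\<lambda>i j. h' i j * v i j - r i j) i j"

text \<open>In the sum of the potential energy balance and the two kinetic ones, the work terms cancel and
  the coefficient \<open>- 1 / \<eta> + 3 h' / (2 \<eta>\<^sup>2) + 3 \<omega>\<^sup>2 dt\<^sup>2 / (2 h')\<close> of \<open>q\<^sup>2 + r\<^sup>2\<close> remains. The bound on the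
  time step makes its last summand at most \<open>\<zeta> (\<eta> - 3 h' / 2) / \<eta>\<^sup>2\<close>.\<close>

lemma local_energy_inequality:
  fixes g \<omega> dx dy dt \<eta> \<zeta> :: real and b h u v h' u' v' q r :: grid
  defines "F \<equiv> flux_x h' u q" and "G \<equiv> flux_y h' v r"
  assumes pos: "dx > 0" "dy > 0" "dt > 0" "\<omega> \<noteq> 0" "\<eta> > 0"  "\<zeta> > 0"
    and scheme: "scheme_step g \<omega> dx dy dt b h u v h' u' v' q r"
    and q: "\<And>i j. q i j = \<eta> * dt * (diff_x dx (potential g b h') i j - \<omega> * v i j)"
    and r: "\<And>i j. r i j = \<eta> * dt * (diff_y dy (potential g b h') i j + \<omega> * u i j)"
    and stab: "\<eta> > 3 / 2 * h' i j"
    and cfl: "1 + 3 * dt / h' i j *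
      (1 / dx * (neg_part (F i j) - pos_part (F (i - 1) j))
       + 1 / dy * (neg_part (G i j) - pos_part (G i (j - 1)))) \<ge> 0"
    and step: "dt\<^sup>2 \<le> \<zeta> * (2 * h' i j / (3 * \<omega>\<^sup>2 * \<eta>\<^sup>2)) * (\<eta> - 3 / 2 * h' i j)"
  shows "energy g b h' u' v' i j - energy g b h u v i j
      + dt * ((energy_flux_x g b u v h' q i j - energy_flux_x g b u v h' q (i - 1) j) / dx
            + (energy_flux_y g b u v h' r i j - energy_flux_y g b u v h' r i (j - 1)) / dy)
    \<le> - (g / 2 * (h' i j - h i j)\<^sup>2)
      - (1 - \<zeta>) / \<eta>\<^sup>2 * (\<eta> - 3 / 2 * h' i j) * ((q i j)\<^sup>2 + (r i j)\<^sup>2)"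
proof -
  define H where "H = h' i j"
  define Q where "Q = (q i j)\<^sup>2 + (r i j)\<^sup>2"
  \<comment> \<open>A nonpositive height would leave no admissible positive time step.\<close>
  have H: "H > 0"
  proof (rule ccontr)
    assume "\<not> H > 0"
    then have "\<zeta> * (2 * H / (3 * \<omega>\<^sup>2 * \<eta>\<^sup>2)) \<le> 0"
      using pos by (auto intro!: mult_nonneg_nonpos divide_nonpos_nonneg)
    then have "\<zeta> * (2 * H / (3 * \<omega>\<^sup>2 * \<eta>\<^sup>2)) * (\<eta> - 3 / 2 * H) \<le> 0"
      by (rule mult_nonpos_nonneg) (use stab in \<open>simp add: H_def\<close>)
    moreover have "dt\<^sup>2 > 0" using pos by simp
    ultimately show False using step unfolding H_def by linarith
  qed
  have s: "(h' i j - h i j) / dt + (F i j - F (i - 1) j) / dx + (G i j - G i (j - 1)) / dy = 0"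
    "(h' i j * u' i j - h i j * u i j) / dt
          + (F i j * upwind_x F u i j - F (i - 1) j * upwind_x F u (i - 1) j) / dx
          + (G i j * upwind_y G u i j - G i (j - 1) * upwind_y G u i (j - 1)) / dy
          + h' i j * diff_x dx (potential g b h') i j
          = \<omega> * h' i j * v i j - \<omega> * r i j"
    "(h' i j * v' i j - h i j * v i j) / dt
          + (F i j * upwind_x F v i j - F (i - 1) j * upwind_x F v (i - 1) j) / dx
          + (G i j * upwind_y G v i j - G i (j - 1) * upwind_y G v i (j - 1)) / dy
          + h' i j * diff_y dy (potential g b h') i j
          = - \<omega> * h' i j * u i j + \<omega> * q i j"
    using scheme unfolding scheme_step_def Let_def F_def[symmetric] G_def[symmetric] by blast+
  \<comment> \<open>The stabilisation terms are proportional to the combined pressure and Coriolis forces.\<close>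
  have src_x: "H * diff_x dx (potential g b h') i j - \<omega> * H * v i j = H * q i j / (\<eta> * dt)"
    and src_y: "H * diff_y dy (potential g b h') i j + \<omega> * H * u i j = H * r i j / (\<eta> * dt)"
    using pos unfolding q r by (simp_all add: field_simps)
  have mx: "(h' i j * u' i j - h i j * u i j) / dt
          + (F i j * upwind_x F u i j - F (i - 1) j * upwind_x F u (i - 1) j) / dx
          + (G i j * upwind_y G u i j - G i (j - 1) * upwind_y G u i (j - 1)) / dy
        = (- H * q i j / \<eta> + - \<omega> * dt * r i j) / dt"
  proof -
    have "(- H * q i j / \<eta> + - \<omega> * dt * r i j) / dt = - (H * q i j / (\<eta> * dt)) - \<omega> * r i j"
      using pos by (simp add: field_simps)
    then show ?thesis using s(2) src_x by (simp add: H_def)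
  qed
  have my: "(h' i j * v' i j - h i j * v i j) / dt
          + (F i j * upwind_x F v i j - F (i - 1) j * upwind_x F v (i - 1) j) / dx
          + (G i j * upwind_y G v i j - G i (j - 1) * upwind_y G v i (j - 1)) / dy
        = (- H * r i j / \<eta> + \<omega> * dt * q i j) / dt"
  proof -
    have "(- H * r i j / \<eta> + \<omega> * dt * q i j) / dt = - (H * r i j / (\<eta> * dt)) + \<omega> * q i j"
      using pos by (simp add: field_simps)
    then show ?thesis using s(3) src_y by (simp add: H_def)
  qed
  note kinetic = upwind_kinetic_energy[where h = h and h' = h' and F = F and G = G and i = i and j = j,
      OF pos(3,1,2) H[unfolded H_def] s(1) _ cfl]
  note kinetic_u = kinetic[where w = u and w' = u', OF mx]
    and kinetic_v = kinetic[where w = v and w' = v', OF my]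
  have pe: "1 / 2 * g * (h' i j)\<^sup>2 + g * b i j * h' i j - (1 / 2 * g * (h i j)\<^sup>2 + g * b i j * h i j)
      + dt * ((cross_x (potential g b h') (\<lambda>i j. h' i j * u i j - q i j) i j
               - cross_x (potential g b h') (\<lambda>i j. h' i j * u i j - q i j) (i - 1) j) / dx
            + (cross_y (potential g b h') (\<lambda>i j. h' i j * v i j - r i j) i j
               - cross_y (potential g b h') (\<lambda>i j. h' i j * v i j - r i j) i (j - 1)) / dy)
    = h' i j * (u i j * q i j + v i j * r i j) / \<eta> - ((q i j)\<^sup>2 + (r i j)\<^sup>2) / \<eta>
      + \<omega> * dt * (u i j * r i j - v i j * q i j) - g / 2 * (h' i j - h i j)\<^sup>2"
    using q r s(1)[unfolded F_def G_def]
    by (intro potential_energy_balance[OF pos(3,5)])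
  have stepQ: "3 / (2 * H) * (\<omega> * dt)\<^sup>2 * Q \<le> \<zeta> / \<eta>\<^sup>2 * (\<eta> - 3 / 2 * H) * Q"
  proof (rule mult_right_mono)
    have "3 / (2 * H) * \<omega>\<^sup>2 * dt\<^sup>2 \<le> 3 / (2 * H) * \<omega>\<^sup>2 *
       (\<zeta> * (2 * H / (3 * \<omega>\<^sup>2 * \<eta>\<^sup>2)) * (\<eta> - 3 / 2 * H))"
      using step H by (intro mult_left_mono) (auto simp: H_def)
    also have "\<dots> = \<zeta> / \<eta>\<^sup>2 * (\<eta> - 3 / 2 * H)"
      using H pos by (simp add: field_simps)
    finally show "3 / (2 * H) * (\<omega> * dt)\<^sup>2 \<le> \<zeta> / \<eta>\<^sup>2 * (\<eta> - 3 / 2 * H)"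
      by (simp add: power_mult_distrib mult.assoc)
  qed (simp add: Q_def)
  have "u i j * (- H * q i j / \<eta> + - \<omega> * dt * r i j)
      + 3 / (2 * H) * ((- H * q i j / \<eta>)\<^sup>2 + (- \<omega> * dt * r i j)\<^sup>2)
      + (v i j * (- H * r i j / \<eta> + \<omega> * dt * q i j)
      + 3 / (2 * H) * ((- H * r i j / \<eta>)\<^sup>2 + (\<omega> * dt * q i j)\<^sup>2))
      + (H * (u i j * q i j + v i j * r i j) / \<eta> - Q / \<eta>
      + \<omega> * dt * (u i j * r i j - v i j * q i j))
    = - (\<eta> - 3 / 2 * H) / \<eta>\<^sup>2 * Q + 3 / (2 * H) * (\<omega> * dt)\<^sup>2 * Q"
    using H pos by (simp add: Q_def field_simps power2_eq_square)
  also have "\<dots> \<le> - (\<eta> - 3 / 2 * H) / \<eta>\<^sup>2 * Q + \<zeta> / \<eta>\<^sup>2 * (\<eta> - 3 / 2 * H) * Q"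
    using stepQ by simp
  also have "\<dots> = - ((1 - \<zeta>) / \<eta>\<^sup>2 * (\<eta> - 3 / 2 * H) * Q)"
    using pos by (simp add: field_simps)
  finally show ?thesis
    using kinetic_u kinetic_v pe
    unfolding H_def[symmetric] Q_def[symmetric] energy_def energy_flux_x_def energy_flux_y_def
      F_def[symmetric] G_def[symmetric]
    by (simp add: H_def[symmetric] algebra_simps add_divide_distrib diff_divide_distrib)
qed

section \<open>Summation over the mesh\<close>

lemma grid_sum_mono:
  "\<forall>i j. y i j \<le> z i j \<Longrightarrow> grid_sum nx ny y \<le> grid_sum nx ny z"
  by (auto simp: grid_sum_def intro!: sum_mono)

lemma grid_sum_linear:
  "grid_sum nx ny (\<lambda>i j. y i j + z i j) = grid_sum nx ny y + grid_sum nx ny z"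
  "grid_sum nx ny (\<lambda>i j. c * z i j) = c * grid_sum nx ny z"
  by (simp_all add: grid_sum_def sum.distrib sum_distrib_left)

lemma energy_flux_periodic:
  assumes "grid_periodic nx ny b" "grid_periodic nx ny u" "grid_periodic nx ny v"
    "grid_periodic nx ny h'" "grid_periodic nx ny q" "grid_periodic nx ny r"
  shows "grid_periodic nx ny (energy_flux_x g b u v h' q)"
    and "grid_periodic nx ny (energy_flux_y g b u v h' r)"
  unfolding grid_periodic_def[of _ _ "energy_flux_x g b u v h' q"]
    grid_periodic_def[of _ _ "energy_flux_y g b u v h' r"]
  by (simp_all add: energy_flux_x_def energy_flux_y_def flux_x_def flux_y_def upwind_x_def
    upwind_y_def cross_x_def cross_y_def potential_def avg_x_def avg_y_def
    assms[THEN grid_periodic_neighbours(1)] assms[THEN grid_periodic_neighbours(2)]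
    assms[THEN grid_periodic_neighbours(3)] assms[THEN grid_periodic_neighbours(4)])

lemma global_energy_inequality:
  fixes g \<omega> dx dy dt \<eta> \<zeta> :: real and b h u v h' u' v' q r :: grid
  defines "F \<equiv> flux_x h' u q" and "G \<equiv> flux_y h' v r"
  assumes pos: "dx > 0" "dy > 0" "dt > 0" "\<omega> \<noteq> 0" "\<eta> > 0" "\<zeta> > 0"
    and per: "grid_periodic nx ny b" "grid_periodic nx ny u" "grid_periodic nx ny v"
      "grid_periodic nx ny h'"
    and scheme: "scheme_step g \<omega> dx dy dt b h u v h' u' v' q r"
    and q: "\<And>i j. q i j = \<eta> * dt * (diff_x dx (potential g b h') i j - \<omega> * v i j)"
    and r: "\<And>i j. r i j = \<eta> * dt * (diff_y dy (potential g b h') i j + \<omega> * u i j)"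
    and stab: "\<And>i j. \<eta> > 3 / 2 * h' i j"
    and cfl: "\<And>i j. 1 + 3 * dt / h' i j *
      (1 / dx * (neg_part (F i j) - pos_part (F (i - 1) j))
       + 1 / dy * (neg_part (G i j) - pos_part (G i (j - 1)))) \<ge> 0"
    and step: "\<And>i j. dt\<^sup>2 \<le> \<zeta> * (2 * h' i j / (3 * \<omega>\<^sup>2 * \<eta>\<^sup>2)) * (\<eta> - 3 / 2 * h' i j)"
  shows "grid_sum nx ny (\<lambda>i j. dx * dy * energy g b h' u' v' i j)
      + g / 2 * grid_sum nx ny (\<lambda>i j. dx * dy * (h' i j - h i j)\<^sup>2)
      + grid_sum nx ny (\<lambda>i j. dx * dy * ((1 - \<zeta>) / \<eta>\<^sup>2) * (\<eta> - 3 / 2 * h' i j)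
          * ((q i j)\<^sup>2 + (r i j)\<^sup>2))
    \<le> grid_sum nx ny (\<lambda>i j. dx * dy * energy g b h u v i j)"
proof -
  have per_qr: "grid_periodic nx ny q" "grid_periodic nx ny r"
    unfolding grid_periodic_def[of _ _ q] grid_periodic_def[of _ _ r]
    by (simp_all add: q r diff_x_def diff_y_def avg_x_def avg_y_def potential_def
      per[THEN grid_periodic_neighbours(1)] per[THEN grid_periodic_neighbours(2)]
      per[THEN grid_periodic_neighbours(3)] per[THEN grid_periodic_neighbours(4)]
      per[THEN grid_periodic_neighbours(5)] per[THEN grid_periodic_neighbours(6)])
  let ?X = "energy_flux_x g b u v h' q" and ?Y = "energy_flux_y g b u v h' r"
  have "\<forall>i j. dx * dy * energy g b h' u' v' i j + g / 2 * (dx * dy * (h' i j - h i j)\<^sup>2)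
      + dx * dy * ((1 - \<zeta>) / \<eta>\<^sup>2) * (\<eta> - 3 / 2 * h' i j) * ((q i j)\<^sup>2 + (r i j)\<^sup>2)
      + (dt * dy * (?X i j - ?X (i - 1) j) + dt * dx * (?Y i j - ?Y i (j - 1)))
    \<le> dx * dy * energy g b h u v i j"
  proof (intro allI)
    fix i j
    have "dx * dy * (energy g b h' u' v' i j - energy g b h u v i j
        + dt * ((?X i j - ?X (i - 1) j) / dx + (?Y i j - ?Y i (j - 1)) / dy))
      \<le> dx * dy * (- (g / 2 * (h' i j - h i j)\<^sup>2)
        - (1 - \<zeta>) / \<eta>\<^sup>2 * (\<eta> - 3 / 2 * h' i j) * ((q i j)\<^sup>2 + (r i j)\<^sup>2))"
      using pos local_energy_inequality[OF pos scheme q r stab cfl[unfolded F_def G_def] step]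
      by (intro mult_left_mono) auto
    moreover have "dx * dy * (dt * ((?X i j - ?X (i - 1) j) / dx + (?Y i j - ?Y i (j - 1)) / dy))
       = dt * dy * (?X i j - ?X (i - 1) j) + dt * dx * (?Y i j - ?Y i (j - 1))"
      using pos by (simp add: field_simps)
    ultimately show "dx * dy * energy g b h' u' v' i j + g / 2 * (dx * dy * (h' i j - h i j)\<^sup>2)
      + dx * dy * ((1 - \<zeta>) / \<eta>\<^sup>2) * (\<eta> - 3 / 2 * h' i j) * ((q i j)\<^sup>2 + (r i j)\<^sup>2)
      + (dt * dy * (?X i j - ?X (i - 1) j) + dt * dx * (?Y i j - ?Y i (j - 1)))
    \<le> dx * dy * energy g b h u v i j"
      unfolding right_diff_distrib[of "dx * dy"] distrib_left[of "dx * dy"] mult_minus_right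
      by (simp add: mult.assoc mult.left_commute)
  qed
  from grid_sum_mono[OF this, of nx ny] show ?thesis
    unfolding grid_sum_linear grid_sum_div_x[OF energy_flux_periodic(1)[OF per per_qr]]
      grid_sum_div_y[OF energy_flux_periodic(2)[OF per per_qr]]
    by simp
qed

theorem theorem1p5:
  fixes nx ny N :: nat
    and x0 y0 dx dy T dt g \<omega> \<eta> \<zeta> :: real
    and b h0 u0 v0 :: "real \<times> real \<Rightarrow> real"
    and bb :: grid
    and h u v q r F G :: "nat \<Rightarrow> grid"
  assumes mesh: "nx > 0" "ny > 0" "dx > 0" "dy > 0"
    and time: "T > 0" "N > 0" "dt = T / real N"
    and params: "g > 0" "\<omega> \<noteq> 0" "\<eta> > 0" "0 < \<zeta>" "\<zeta> < 1"
    and topography: "torus_Wkinf 2 (real nx * dx) (real ny * dy) b"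
    and bb: "bb = cell_avg x0 y0 dx dy b"
    and initial_data:
      "torus_Linf (real nx * dx) (real ny * dy) h0" "AE p in lebesgue. h0 p > 0"
      "torus_Linf (real nx * dx) (real ny * dy) u0"
      "torus_Linf (real nx * dx) (real ny * dy) v0"
    and initial: "h 0 = cell_avg x0 y0 dx dy h0"
      "u 0 = cell_avg x0 y0 dx dy u0"
      "v 0 = cell_avg x0 y0 dx dy v0"
    and periodic: "\<forall>n\<le>N. grid_periodic nx ny (h n) \<and> grid_periodic nx ny (u n) \<and>
      grid_periodic nx ny (v n)"
    and scheme: "\<forall>n<N. scheme_step g \<omega> dx dy dt bb (h n) (u n) (v n)
      (h (Suc n)) (u (Suc n)) (v (Suc n)) (q (Suc n)) (r (Suc n))"
    and q: "\<forall>n<N. \<forall>i j. q (Suc n) i j =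
      \<eta> * dt * (diff_x dx (potential g bb (h (Suc n))) i j - \<omega> * v n i j)"
    and r: "\<forall>n<N. \<forall>i j. r (Suc n) i j =
      \<eta> * dt * (diff_y dy (potential g bb (h (Suc n))) i j + \<omega> * u n i j)"
    and F: "\<forall>n<N. F (Suc n) = flux_x (h (Suc n)) (u n) (q (Suc n))"
    and G: "\<forall>n<N. G (Suc n) = flux_y (h (Suc n)) (v n) (r (Suc n))"
    and cond1: "\<forall>n<N. \<forall>i j. \<eta> > 3 / 2 * h (Suc n) i j"
    and cond2: "\<forall>n<N. \<forall>i j. 1 + 3 * dt / h (Suc n) i j *
      (1 / dx * (neg_part (F (Suc n) i j) - pos_part (F (Suc n) (i - 1) j))
       + 1 / dy * (neg_part (G (Suc n) i j) - pos_part (G (Suc n) i (j - 1)))) \<ge> 0"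
    and cond3: "\<forall>n<N. \<forall>i j. dt\<^sup>2 \<le>
      \<zeta> * (2 * h (Suc n) i j / (3 * \<omega>\<^sup>2 * \<eta>\<^sup>2)) * (\<eta> - 3 / 2 * h (Suc n) i j)"
  shows "(\<forall>n<N.
       grid_sum nx ny (\<lambda>i j. dx * dy * energy g bb (h (Suc n)) (u (Suc n)) (v (Suc n)) i j)
       \<le> grid_sum nx ny (\<lambda>i j. dx * dy * energy g bb (h n) (u n) (v n) i j)) \<and>
    (\<forall>n. 1 \<le> n \<and> n \<le> N \<longrightarrow>
       grid_sum nx ny (\<lambda>i j. dx * dy * energy g bb (h n) (u n) (v n) i j)
       + g / 2 * (\<Sum>k<n. grid_sum nx ny (\<lambda>i j. dx * dy * (h (Suc k) i j - h k i j)\<^sup>2))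
       + (\<Sum>k<n. grid_sum nx ny (\<lambda>i j. dx * dy * ((1 - \<zeta>) / \<eta>\<^sup>2) *
            (\<eta> - 3 / 2 * h (Suc k) i j) * ((q (Suc k) i j)\<^sup>2 + (r (Suc k) i j)\<^sup>2)))
       \<le> grid_sum nx ny (\<lambda>i j. dx * dy * energy g bb (h 0) (u 0) (v 0) i j))"
proof -
  have dt: "dt > 0" using time by simp
  have per_b: "grid_periodic nx ny bb"
    unfolding bb using topography by (intro cell_avg_periodic) (simp add: torus_Wkinf_def)
  let ?E = "\<lambda>n. grid_sum nx ny (\<lambda>i j. dx * dy * energy g bb (h n) (u n) (v n) i j)"
  let ?A = "\<lambda>k. grid_sum nx ny (\<lambda>i j. dx * dy * (h (Suc k) i j - h k i j)\<^sup>2)"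
  let ?B = "\<lambda>k. grid_sum nx ny (\<lambda>i j. dx * dy * ((1 - \<zeta>) / \<eta>\<^sup>2) *
            (\<eta> - 3 / 2 * h (Suc k) i j) * ((q (Suc k) i j)\<^sup>2 + (r (Suc k) i j)\<^sup>2))"
  have step: "?E (Suc n) + g / 2 * ?A n + ?B n \<le> ?E n" if n: "n < N" for n
    using periodic n per_b
    by (intro global_energy_inequality[OF mesh(3,4) dt params(2-4) _ _ _ _
        scheme[rule_format, OF n] q[rule_format, OF n] r[rule_format, OF n]
        cond1[rule_format, OF n]
        cond2[rule_format, OF n, unfolded F[rule_format, OF n] G[rule_format, OF n]]
        cond3[rule_format, OF n]]) auto
  have A0: "?A n \<ge> 0" for n
    using mesh by (simp add: grid_sum_def sum_nonneg)
  have B0: "?B n \<ge> 0" if "n < N" for n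
    unfolding grid_sum_def using mesh params cond1 that
    by (intro sum_nonneg mult_nonneg_nonneg[of _ "(_)\<^sup>2 + (_)\<^sup>2"] mult_nonneg_nonneg)
      (auto intro: less_imp_le)
  have "?E (Suc n) \<le> ?E n" if "n < N" for n
  proof -
    have "g / 2 * ?A n \<ge> 0" using params A0[of n] by (intro mult_nonneg_nonneg) auto
    then show ?thesis using step[OF that] B0[OF that] by linarith
  qed
  moreover have "?E n + g / 2 * (\<Sum>k<n. ?A k) + (\<Sum>k<n. ?B k) \<le> ?E 0" if "n \<le> N" for n
    using that
  proof (induction n)
    case (Suc n)
    then show ?case
      using step[of n] by (simp add: distrib_left)
  qed simp
  ultimately show ?thesis by blast
qed

end
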